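(* For any norm $\|\cdot\|$ on a real vector space $V$, let $S:=\{x\in V : \|x\|=1\}$ be the unit sphere of $V$ and let $d$ denote the intrinsic metric on $S$. Then for all $x,y\in S$, $$\|x-y\|\leq d(x,y)\leq \sqrt{2}\,\pi\,\|x-y\|.$$
   Context: The length of a continuous path $\rho:[0,1]\to S$ (continuity with respect to $\|\cdot\|$) is $$L(\rho):=\sup\left\{\sum_{j=0}^{n-1}\|\rho(t_j)-\rho(t_{j+1})\| \;:\; n\in\mathbb{N},\ 0=t_0<\dots<t_n=1\right\}\in[0,\infty].$$ The intrinsic metric on $S$ is the (extended) metric $$d(x,y):=\inf\{L(\rho) : \rho:[0,1]\to S \text{ continuous},\ \rho(0)=x,\ \rho(1)=y\}\in[0,\infty]\qquad(x,y\in S).$$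
   Formalization: The upper bound is stated only when V is not one-dimensional, since for dim V = 1 the sphere is {e, −e}, no path joins the two points, and d(e, −e) is infinite; the lower bound is for every V. *)

theory Defs
  imports "HOL-Analysis.Analysis"
begin

(* Only t 0, ..., t n matter; the endpoint conditions force n \<ge> 1. *)
definition unit_partition :: "nat \<Rightarrow> (nat \<Rightarrow> real) \<Rightarrow> bool" where
  "unit_partition n t \<longleftrightarrow> t 0 = 0 \<and> t n = 1 \<and> (\<forall>j<n. t j < t (Suc j))"

definition path_length :: "(real \<Rightarrow> 'a::real_normed_vector) \<Rightarrow> ennreal" where
  "path_length \<rho> =
     Sup {ennreal (\<Sum>j<n. norm (\<rho> (t j) - \<rho> (t (Suc j)))) | n t. unit_partition n t}"

(* The value is \<infinity> (= Inf {}) if no path in S joins x to y. *)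
definition intrinsic_dist ::
    "'a::real_normed_vector set \<Rightarrow> 'a \<Rightarrow> 'a \<Rightarrow> ennreal" where
  "intrinsic_dist S x y =
     Inf {path_length \<rho> | \<rho>. path \<rho> \<and> path_image \<rho> \<subseteq> S \<and> pathstart \<rho> = x \<and> pathfinish \<rho> = y}"

end

theory Submission
  imports Defs
begin

text \<open>
  The lower bound is the triangle inequality. For the upper bound let \<open>y \<noteq> x, - x\<close>, put
  \<open>w = (y - x) / \<parallel>y - x\<parallel>\<close>, let \<open>p\<close> be a point of minimal norm \<open>m\<close> on the segment from \<open>x\<close> to
  \<open>y\<close>, and project the segment radially to the sphere. Writing \<open>f t = \<parallel>p + t w\<parallel>\<close>, the projected point
  is \<open>(1 / f t) p + (t / f t) w\<close>. On either side of \<open>p\<close> the function \<open>f\<close> is monotone and 1-Lipschitz,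
  which makes the coordinate functions differences of monotone functions and bounds the length of that
  side, over a piece of the segment of length \<open>T\<close>, by \<open>T + 3 (1 - m)\<close>. As \<open>1 - m \<le> \<parallel>x - y\<parallel> / 2\<close>, the
  total is at most \<open>4 \<parallel>x - y\<parallel>\<close>. Since \<open>4 < sqrt 2 * pi\<close>, there is room to treat antipodal points by a
  detour through a point very close to \<open>- x\<close>.
\<close>

section \<open>Paths of controlled length: reversal and concatenation\<close>

text \<open>
  \<open>G\<close> plays the role of arc length; any function dominating the increments bounds the length of \<open>g\<close>.
\<close>

definition joined_within :: "'a::real_normed_vector set \<Rightarrow> 'a \<Rightarrow> 'a \<Rightarrow> real \<Rightarrow> bool" where
  "joined_within S x y L \<longleftrightarrow>
     (\<exists>g G. path g \<and> path_image g \<subseteq> S \<and> pathstart g = x \<and> pathfinish g = y \<and>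
       (\<forall>s t. 0 \<le> s \<longrightarrow> s \<le> t \<longrightarrow> t \<le> 1 \<longrightarrow> norm (g t - g s) \<le> G t - G s) \<and>
       G 1 - G 0 \<le> L)"

lemma unit_partition_mono:
  assumes "unit_partition n t" "i \<le> j" "j \<le> n"
  shows "t i \<le> t j"
  using assms(2,3)
proof (induction j rule: dec_induct)
  case (step k)
  then have "t k < t (Suc k)"
    using assms(1) by (auto simp: unit_partition_def)
  with step show ?case by simp
qed simp

lemma intrinsic_dist_le_if_joined_within:
  assumes "joined_within S x y L"
  shows "intrinsic_dist S x y \<le> ennreal L"
proof -
  obtain g G where g: "path g" "path_image g \<subseteq> S" "pathstart g = x" "pathfinish g = y"
    and G: "\<And>s t. 0 \<le> s \<Longrightarrow> s \<le> t \<Longrightarrow> t \<le> 1 \<Longrightarrow> norm (g t - g s) \<le> G t - G s"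
    and L: "G 1 - G 0 \<le> L"
    using assms unfolding joined_within_def by blast
  have "(\<Sum>j<n. norm (g (t j) - g (t (Suc j)))) \<le> L" if "unit_partition n t" for n t
  proof -
    have ends: "t 0 = 0" "t n = 1"
      using that by (auto simp: unit_partition_def)
    have "(\<Sum>j<n. norm (g (t j) - g (t (Suc j)))) \<le> (\<Sum>j<n. G (t (Suc j)) - G (t j))"
    proof (rule sum_mono)
      fix j assume "j \<in> {..<n}"
      then have "t 0 \<le> t j" "t j \<le> t (Suc j)" "t (Suc j) \<le> t n"
        using unit_partition_mono[OF that] by auto
      then show "norm (g (t j) - g (t (Suc j))) \<le> G (t (Suc j)) - G (t j)"
        using G[of "t j" "t (Suc j)"] ends by (simp add: norm_minus_commute)
    qed
    also have "\<dots> = G 1 - G 0"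
      by (simp add: sum_lessThan_telescope[of "\<lambda>j. G (t j)"] ends)
    finally show ?thesis using L by simp
  qed
  then have "path_length g \<le> ennreal L"
    unfolding path_length_def by (intro Sup_least) (auto intro: ennreal_leI)
  moreover have "intrinsic_dist S x y \<le> path_length g"
    unfolding intrinsic_dist_def using g by (intro Inf_lower) auto
  ultimately show ?thesis by (rule order_trans[rotated])
qed

lemma joined_within_mono:
  "joined_within S x y L \<Longrightarrow> L \<le> L' \<Longrightarrow> joined_within S x y L'"
  unfolding joined_within_def by (elim exE) (intro exI, auto)

lemma joined_within_refl:
  assumes "x \<in> S"
  shows "joined_within S x x 0"
  unfolding joined_within_def
  by (rule exI[of _ "\<lambda>_. x"], rule exI[of _ "\<lambda>_. 0"])
    (use assms in \<open>auto simp: path_def path_image_def pathstart_def pathfinish_def\<close>)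

lemma joined_within_sym:
  assumes "joined_within S x y L"
  shows "joined_within S y x L"
proof -
  obtain g G where g: "path g" "path_image g \<subseteq> S" "pathstart g = x" "pathfinish g = y"
    and G: "\<And>s t. 0 \<le> s \<Longrightarrow> s \<le> t \<Longrightarrow> t \<le> 1 \<Longrightarrow> norm (g t - g s) \<le> G t - G s"
    and L: "G 1 - G 0 \<le> L"
    using assms unfolding joined_within_def by blast
  have "norm (reversepath g t - reversepath g s) \<le> - G (1 - t) - - G (1 - s)"
    if "0 \<le> s" "s \<le> t" "t \<le> 1" for s t
    using G[of "1 - t" "1 - s"] that by (simp add: reversepath_def norm_minus_commute)
  then show ?thesis
    unfolding joined_within_def using g L
    by (intro exI[of _ "reversepath g"] exI[of _ "\<lambda>t. - G (1 - t)"]) auto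
qed

lemma joined_within_trans:
  assumes "joined_within S x y L" and "joined_within S y z M"
  shows "joined_within S x z (L + M)"
proof -
  obtain g G where g: "path g" "path_image g \<subseteq> S" "pathstart g = x" "pathfinish g = y"
    and G: "\<And>s t. 0 \<le> s \<Longrightarrow> s \<le> t \<Longrightarrow> t \<le> 1 \<Longrightarrow> norm (g t - g s) \<le> G t - G s"
    and L: "G 1 - G 0 \<le> L"
    using assms(1) unfolding joined_within_def by blast
  obtain h H where h: "path h" "path_image h \<subseteq> S" "pathstart h = y" "pathfinish h = z"
    and H: "\<And>s t. 0 \<le> s \<Longrightarrow> s \<le> t \<Longrightarrow> t \<le> 1 \<Longrightarrow> norm (h t - h s) \<le> H t - H s"
    and M: "H 1 - H 0 \<le> M"
    using assms(2) unfolding joined_within_def by blast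
  \<comment> \<open>\<open>H\<close> is shifted to start at the value \<open>G 1\<close>, so that
    increments across the junction add up.\<close>
  define K where "K t = (if t \<le> 1/2 then G (2 * t) else G 1 + (H (2 * t - 1) - H 0))" for t
  have "norm ((g +++ h) t - (g +++ h) s) \<le> K t - K s"
    if st: "0 \<le> s" "s \<le> t" "t \<le> 1" for s t
  proof -
    consider "t \<le> 1/2" | "1/2 < s" | "s \<le> 1/2" "1/2 < t" by linarith
    then show ?thesis
    proof cases
      case 1
      then show ?thesis using st G[of "2 * s" "2 * t"] by (simp add: joinpaths_def K_def)
    next
      case 2
      then show ?thesis
        using st H[of "2 * s - 1" "2 * t - 1"] by (simp add: joinpaths_def K_def)
    next
      case 3
      have "norm (h (2 * t - 1) - g (2 * s)) \<le> norm (h (2 * t - 1) - h 0) + norm (g 1 - g (2 * s))"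
        using norm_triangle_ineq[of "h (2 * t - 1) - h 0" "g 1 - g (2 * s)"] g h
        by (simp add: pathstart_def pathfinish_def)
      also have "\<dots> \<le> (H (2 * t - 1) - H 0) + (G 1 - G (2 * s))"
        using 3 st by (intro add_mono G H) auto
      finally show ?thesis using 3 by (simp add: joinpaths_def K_def)
    qed
  qed
  moreover have "K 1 - K 0 \<le> L + M"
    using L M by (simp add: K_def)
  moreover have "path (g +++ h)" "path_image (g +++ h) \<subseteq> S"
    using g h by (auto simp: path_image_join)
  ultimately show ?thesis
    unfolding joined_within_def using g h
    by (intro exI[of _ "g +++ h"] exI[of _ K]) auto
qed

section \<open>Radial projection of a segment to the sphere\<close>

text \<open>The coefficient of \<open>p\<close> contributes \<open>m * (1 / m - 1) = 1 - m\<close>.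
  That of \<open>w\<close> contributes at most \<open>T\<close> plus
  \<open>2 * k * (1 / m - 1)\<close>, where the second term is at most
  \<open>2 * (1 - m)\<close>.\<close>

lemma joined_within_sphere_from_minimum:
  fixes p w :: "'a::real_normed_vector"
  assumes p: "p \<noteq> 0" and w: "norm w = 1" and T: "0 \<le> T" and end1: "norm (p + T *\<^sub>R w) = 1"
    and min: "\<And>t. 0 \<le> t \<Longrightarrow> t \<le> T \<Longrightarrow> norm p \<le> norm (p + t *\<^sub>R w)"
  shows "joined_within (sphere 0 1) (p /\<^sub>R norm p) (p + T *\<^sub>R w) (T + 3 * (1 - norm p))"
proof -
  define m where "m = norm p"
  define f where "f t = norm (p + t *\<^sub>R w)" for t
  define u where "u t = (p + t *\<^sub>R w) /\<^sub>R f t" for t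
  \<comment> \<open>The least nonnegative shift with \<open>T - k \<le> 1 = f T\<close>. As
    \<open>f\<close> is 1-Lipschitz, this yields \<open>s - k \<le> f s\<close> for every
    \<open>s \<le> T\<close>.\<close>
  define k where "k = max 0 (T - 1)"
  \<comment> \<open>This is \<open>(t - k) / f t - (m + k) / f t\<close>, where both summands are
    nondecreasing on the interval.\<close>
  define G where "G t = (t - m - 2 * k) / f t" for t
  have m0: "0 < m" using p by (simp add: m_def)
  have f0: "f 0 = m" and fT: "f T = 1" by (simp_all add: f_def m_def end1)
  have m_le: "m \<le> f t" if "0 \<le> t" "t \<le> T" for t
    using min[OF that] by (simp add: m_def f_def)
  have f_pos: "0 < f t" if "0 \<le> t" "t \<le> T" for t
    using m_le[OF that] m0 by simp
  have lip: "f t \<le> f s + (t - s)" if "s \<le> t" for s t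
  proof -
    have "p + t *\<^sub>R w = (p + s *\<^sub>R w) + (t - s) *\<^sub>R w"
      by (simp add: algebra_simps)
    then have "f t \<le> f s + norm ((t - s) *\<^sub>R w)"
      unfolding f_def by (metis norm_triangle_ineq)
    then show ?thesis using that w by simp
  qed
  \<comment> \<open>A convex function whose minimum is at the left endpoint is
    nondecreasing.\<close>
  have mono: "f s \<le> f t" if "0 \<le> s" "s \<le> t" "t \<le> T" for s t
  proof (cases "t = 0")
    case False
    define l where "l = s / t"
    have l: "0 \<le> l" "l \<le> 1" "s = l * t" using that False by (auto simp: l_def)
    have "p + s *\<^sub>R w = (1 - l) *\<^sub>R p + l *\<^sub>R (p + t *\<^sub>R w)"
      using l by (simp add: algebra_simps)
    then have "f s \<le> norm ((1 - l) *\<^sub>R p) + norm (l *\<^sub>R (p + t *\<^sub>R w))"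
      unfolding f_def by (metis norm_triangle_ineq)
    also have "\<dots> = (1 - l) * m + l * f t"
      using l by (simp add: m_def f_def)
    also have "\<dots> \<le> (1 - l) * f t + l * f t"
      using l m_le[of t] that by (intro add_right_mono mult_left_mono) auto
    finally show ?thesis by (simp add: algebra_simps)
  qed (use that in auto)
  have k0: "0 \<le> k" by (simp add: k_def)
  have m1: "m \<le> 1" using m_le[of T] T fT by simp
  \<comment> \<open>This bounds the cost of the shift: \<open>k * (1 / m - 1) \<le> 1 - m\<close>,
    however small \<open>m\<close> is.\<close>
  have km: "k \<le> m"
  proof -
    have "T = norm (p + T *\<^sub>R w - p)" using T w by simp
    also have "\<dots> \<le> 1 + m"
      using norm_triangle_ineq4[of "p + T *\<^sub>R w" p] end1 by (simp add: m_def)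
    finally show ?thesis using m0 by (simp add: k_def)
  qed
  \<comment> \<open>\<open>t / f t\<close> itself need not be monotone when \<open>T > 1\<close>; the shift by \<open>k\<close> repairs this.\<close>
  have shifted_mono: "(s - k) / f s \<le> (t - k) / f t" if "0 \<le> s" "s \<le> t" "t \<le> T" for s t
  proof -
    \<comment> \<open>For \<open>k \<le> s\<close> the slow growth of \<open>f\<close> suffices,
      thanks to \<open>s - k \<le> f s\<close>; for \<open>s < k\<close> the left factor is negative
      and the growth of \<open>f\<close> helps.\<close>
    have "(s - k) * f t \<le> (t - k) * f s"
    proof (cases "k \<le> s")
      case True
      have "s - k \<le> f s" using lip[of s T] fT that by (simp add: k_def)
      have "(s - k) * f t \<le> (s - k) * (f s + (t - s))"
        using True lip[of s t] that by (intro mult_left_mono) auto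
      also have "\<dots> \<le> (s - k) * f s + f s * (t - s)"
        using \<open>s - k \<le> f s\<close> that by (simp add: distrib_left mult_right_mono)
      finally show ?thesis by (simp add: algebra_simps)
    next
      case False
      have "(s - k) * f t \<le> (s - k) * f s"
        using False mono[OF that] by (intro mult_left_mono_neg) auto
      also have "\<dots> \<le> (t - k) * f s"
        using that f_pos[of s] by (intro mult_right_mono) auto
      finally show ?thesis .
    qed
    then show ?thesis
      using f_pos[of s] f_pos[of t] that by (simp add: divide_simps mult.commute)
  qed
  have incr: "norm (u t - u s) \<le> G t - G s" if "0 \<le> s" "s \<le> t" "t \<le> T" for s t
  proof -
    have inv: "1 / f t \<le> 1 / f s"
      using mono[OF that] f_pos[of s] that by (intro divide_left_mono) auto
    have "u t - u s = (1 / f t - 1 / f s) *\<^sub>R p + (t / f t - s / f s) *\<^sub>R w"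
      by (simp add: u_def algebra_simps divide_inverse)
    then have "norm (u t - u s) \<le> \<bar>1 / f t - 1 / f s\<bar> * m + \<bar>t / f t - s / f s\<bar>"
      using norm_triangle_ineq[of "(1 / f t - 1 / f s) *\<^sub>R p" "(t / f t - s / f s) *\<^sub>R w"] w
      by (simp add: m_def)
    also have "\<bar>1 / f t - 1 / f s\<bar> * m = (1 / f s - 1 / f t) * m"
      using inv by simp
    \<comment> \<open>Splitting \<open>t / f t\<close> into the nondecreasing
      \<open>(t - k) / f t\<close> and the nonincreasing \<open>k / f t\<close> bounds its increment
      by the sum of their variations.\<close>
    also have "t / f t - s / f s = ((t - k) / f t - (s - k) / f s) + k * (1 / f t - 1 / f s)"
      by (simp add: diff_divide_distrib algebra_simps)
    also have "\<bar>\<dots>\<bar> \<le> ((t - k) / f t - (s - k) / f s) + k * (1 / f s - 1 / f t)"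
    proof -
      have "k * (1 / f t - 1 / f s) \<le> 0" using k0 inv by (simp add: mult_nonneg_nonpos)
      moreover have "k * (1 / f s - 1 / f t) = - (k * (1 / f t - 1 / f s))"
        by (simp only: right_diff_distrib minus_diff_eq)
      ultimately show ?thesis using shifted_mono[OF that] by linarith
    qed
    finally show ?thesis
      by (simp add: G_def diff_divide_distrib add_divide_distrib algebra_simps)
  qed
  have total: "G T - G 0 \<le> T + 3 * (1 - m)"
  proof -
    have "k * (1 / m - 1) \<le> m * (1 / m - 1)"
      using km m0 m1 by (intro mult_right_mono) auto
    also have "\<dots> = 1 - m" using m0 by (simp add: right_diff_distrib)
    finally show ?thesis
      using m0 by (simp add: G_def f0 fT diff_divide_distrib right_diff_distrib)
  qed
  define g where "g s = u (s * T)" for s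
  have range: "0 \<le> s * T \<and> s * T \<le> T" if "0 \<le> s" "s \<le> 1" for s
    using that T by (simp add: mult_left_le_one_le)
  have "continuous_on {0..1} g"
    unfolding g_def u_def f_def
    by (intro continuous_intros ballI) (use f_pos range in \<open>force simp: f_def\<close>)
  then have "path g" by (simp add: path_def)
  moreover have "path_image g \<subseteq> sphere 0 1"
    using f_pos range by (force simp: path_image_def g_def u_def f_def)
  moreover have "pathstart g = p /\<^sub>R norm p" "pathfinish g = p + T *\<^sub>R w"
    using f0 fT by (simp_all add: pathstart_def pathfinish_def g_def u_def m_def)
  moreover have "norm (g t - g s) \<le> G (t * T) - G (s * T)"
    if "0 \<le> s" "s \<le> t" "t \<le> 1" for s t
    unfolding g_def using that range[of s] range[of t] T
    by (intro incr) (auto intro: mult_right_mono)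
  ultimately show ?thesis
    unfolding joined_within_def using total
    by (intro exI[of _ g] exI[of _ "\<lambda>t. G (t * T)"]) (auto simp: m_def)
qed

lemma joined_within_sphere:
  fixes x y :: "'a::real_normed_vector"
  assumes x: "norm x = 1" and y: "norm y = 1" and "y \<noteq> - x"
  shows "joined_within (sphere 0 1) x y (4 * norm (x - y))"
proof (cases "x = y")
  case True
  then show ?thesis using joined_within_refl[of y "sphere 0 1"] y by simp
next
  case False
  define D where "D = norm (y - x)"
  define w where "w = (y - x) /\<^sub>R D"
  have D: "0 < D" and w: "norm w = 1" using False by (auto simp: D_def w_def)
  have y_eq: "y = x + D *\<^sub>R w" using D by (simp add: w_def)
  have "continuous_on {0..D} (\<lambda>t. norm (x + t *\<^sub>R w))"
    by (intro continuous_intros)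
  then obtain r where r: "0 \<le> r" "r \<le> D"
    and r_min: "\<And>t. 0 \<le> t \<Longrightarrow> t \<le> D \<Longrightarrow> norm (x + r *\<^sub>R w) \<le> norm (x + t *\<^sub>R w)"
    using continuous_attains_inf[of "{0..D}" "\<lambda>t. norm (x + t *\<^sub>R w)"] D by auto
  define p where "p = x + r *\<^sub>R w"
  have toy: "p + (D - r) *\<^sub>R w = y" by (simp add: p_def y_eq algebra_simps)
  have tox: "p + r *\<^sub>R (- w) = x" by (simp add: p_def)
  \<comment> \<open>If the segment met 0, then \<open>x\<close> and \<open>y\<close> would be unit
    multiples of \<open>- w\<close> and \<open>w\<close>, hence antipodal.\<close>
  have "p \<noteq> 0"
  proof
    assume "p = 0"
    then have "r *\<^sub>R (- w) = x" "(D - r) *\<^sub>R w = y" using toy tox by simp_all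
    moreover from this have "r = 1" "D - r = 1"
      using x y w r by (metis abs_of_nonneg diff_ge_0_iff_ge norm_minus_cancel norm_scaleR mult.right_neutral)+
    ultimately show False using \<open>y \<noteq> - x\<close> by auto
  qed
  have "joined_within (sphere 0 1) (p /\<^sub>R norm p) (p + (D - r) *\<^sub>R w)
      ((D - r) + 3 * (1 - norm p))"
  proof (rule joined_within_sphere_from_minimum[OF \<open>p \<noteq> 0\<close> w])
    fix t assume "0 \<le> t" "t \<le> D - r"
    then show "norm p \<le> norm (p + t *\<^sub>R w)"
      using r_min[of "r + t"] r by (simp add: p_def algebra_simps)
  qed (use r toy y in auto)
  moreover have "joined_within (sphere 0 1) (p /\<^sub>R norm p) (p + r *\<^sub>R (- w))
      (r + 3 * (1 - norm p))"
  proof (rule joined_within_sphere_from_minimum[OF \<open>p \<noteq> 0\<close>])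
    fix t assume "0 \<le> t" "t \<le> r"
    then show "norm p \<le> norm (p + t *\<^sub>R (- w))"
      using r_min[of "r - t"] r by (simp add: p_def algebra_simps)
  qed (use r w x tox in auto)
  ultimately have "joined_within (sphere 0 1) x y
      ((r + 3 * (1 - norm p)) + ((D - r) + 3 * (1 - norm p)))"
    unfolding tox toy by (blast intro: joined_within_trans joined_within_sym)
  \<comment> \<open>Added up, these give \<open>2 * (1 - norm p) \<le> D\<close>, so the total
    \<open>D + 6 * (1 - norm p)\<close> is at most \<open>4 * D\<close>.\<close>
  moreover have "1 \<le> norm p + (D - r)" "1 \<le> norm p + r"
    using norm_triangle_ineq[of p "(D - r) *\<^sub>R w"] norm_triangle_ineq[of p "r *\<^sub>R (- w)"]
      x y w r by (simp_all add: toy tox del: scaleR_minus_right)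
  ultimately show ?thesis
    by (elim joined_within_mono) (simp add: D_def norm_minus_commute)
qed

section \<open>A nearby point for the antipodal detour\<close>

text \<open>Perturb \<open>x\<close> by \<open>e\<close> along \<open>v\<close> and normalise; each
  move has length at most \<open>e\<close>. Returning to \<open>x\<close> would make
  \<open>v\<close> a multiple of \<open>x\<close>.\<close>

lemma exists_unit_vector_near:
  fixes x v :: "'a::real_normed_vector"
  assumes x: "norm x = 1" and v: "v \<notin> span {x}" and e: "0 < e" "e < 1"
  obtains z where "norm z = 1" "z \<noteq> x" "norm (z - x) \<le> 2 * e"
proof -
  have "v \<noteq> 0" using v span_zero by blast
  define u where "u = x + (e / norm v) *\<^sub>R v"
  have ux: "norm (u - x) = e" using \<open>v \<noteq> 0\<close> e by (simp add: u_def)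
  have un: "\<bar>norm u - 1\<bar> \<le> e" using norm_triangle_ineq3[of u x] ux x by simp
  then have u0: "norm u > 0" using e by linarith
  show thesis
  proof
    show "norm (u /\<^sub>R norm u) = 1" using u0 by simp
    show "u /\<^sub>R norm u \<noteq> x"
    proof
      assume "u /\<^sub>R norm u = x"
      then have "u = norm u *\<^sub>R x" using u0 by auto
      then have "(e / norm v) *\<^sub>R v = (norm u - 1) *\<^sub>R x"
        by (simp add: u_def algebra_simps)
      then have "v = (norm v / e) *\<^sub>R ((norm u - 1) *\<^sub>R x)"
        using \<open>v \<noteq> 0\<close> e by (metis divide_eq_0_iff inverse_divide norm_eq_zero order_less_irrefl
            real_vector_affinity_eq scaleR_scaleR scaleR_one left_inverse)
      then show False using v by (metis span_base span_scale insertI1)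
    qed
    have "u /\<^sub>R norm u - u = (1 / norm u - 1) *\<^sub>R u"
      by (simp add: algebra_simps divide_inverse)
    then have "norm (u /\<^sub>R norm u - u) = \<bar>(1 / norm u - 1) * norm u\<bar>"
      by (simp add: abs_mult)
    also have "\<dots> = \<bar>norm u - 1\<bar>"
      using u0 by (simp add: left_diff_distrib)
    finally have "norm (u /\<^sub>R norm u - u) \<le> e" using un by simp
    then show "norm (u /\<^sub>R norm u - x) \<le> 2 * e"
      using norm_triangle_ineq[of "u /\<^sub>R norm u - u" "u - x"] ux by simp
  qed
qed

section \<open>The two bounds on the intrinsic distance\<close>

lemma sqrt2_pi_gt: "4.2 < sqrt 2 * pi"
proof -
  have "1.4 < sqrt (2::real)" by (rule real_less_rsqrt) (simp add: power2_eq_square)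
  moreover have "3 < pi" using pi_approx by simp
  ultimately have "1.4 * 3 < sqrt 2 * pi" by (intro mult_strict_mono) auto
  then show ?thesis by simp
qed

lemma norm_diff_le_intrinsic_dist: "ennreal (norm (x - y)) \<le> intrinsic_dist S x y"
proof -
  have "ennreal (norm (g 0 - g 1)) \<le> path_length g" for g :: "real \<Rightarrow> 'a"
    unfolding path_length_def
    \<comment> \<open>The partition with a single piece: \<open>real\<close> sends the indices 0 and
      1 to the endpoints.\<close>
    by (rule Sup_upper, rule CollectI, rule exI[of _ 1], rule exI[of _ real])
      (simp add: unit_partition_def)
  then show ?thesis
    unfolding intrinsic_dist_def
    by (intro Inf_greatest) (auto simp: pathstart_def pathfinish_def)
qed

text \<open>In dimension 1 the sphere is two points that no path joins, so their distance is
  infinite. Infinite-dimensional spaces are covered by the upper bound, since \<open>dim\<close> is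
  0 there.\<close>

theorem theorem3p6:
  fixes x y :: "'a::real_normed_vector"
  assumes "x \<in> sphere 0 1" and "y \<in> sphere 0 1"
  shows "ennreal (norm (x - y)) \<le> intrinsic_dist (sphere 0 1) x y \<and>
    (dim (UNIV :: 'a set) \<noteq> 1 \<longrightarrow>
      intrinsic_dist (sphere 0 1) x y \<le> ennreal (sqrt 2 * pi * norm (x - y)))"
proof (intro conjI impI norm_diff_le_intrinsic_dist)
  assume dim: "dim (UNIV :: 'a set) \<noteq> 1"
  have x: "norm x = 1" and y: "norm y = 1" using assms by simp_all
  have "joined_within (sphere 0 1) x y (4.2 * norm (x - y))"
  proof (cases "y = - x")
    case False
    show ?thesis
      by (rule joined_within_mono[OF joined_within_sphere[OF x y False]]) simp
  next
    case True
    have "span {y} \<noteq> UNIV"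
    proof
      assume "span {y} = UNIV"
      moreover have "dim (span {y}) = 1"
        using y by (subst dim_span, subst dim_eq_card_independent) (auto simp: dependent_single)
      ultimately show False using dim by simp
    qed
    then obtain v where "v \<notin> span {y}" by blast
    \<comment> \<open>The choice \<open>1/40\<close> makes the detour cost at most
      \<open>4 * (2 + 1/20) + 4 * (1/20) = 8.4\<close>, which is
      \<open>4.2 * norm (x - y)\<close>.\<close>
    then obtain z where z: "norm z = 1" "z \<noteq> y" "norm (z - y) \<le> 2 * (1/40)"
      using exists_unit_vector_near[OF y, of v "1/40"] by auto
    have "norm (x - y) = 2" using x True by (simp flip: scaleR_2)
    \<comment> \<open>As \<open>y = - x\<close>, having \<open>z\<close> distinct from
      \<open>x\<close> and \<open>y\<close> means that neither leg of the detour joins antipodal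
      points.\<close>
    have "z \<noteq> x" using z \<open>norm (x - y) = 2\<close> by auto
    then have "joined_within (sphere 0 1) x y (4 * norm (x - z) + 4 * norm (z - y))"
      using True z x y by (intro joined_within_trans[of _ x z] joined_within_sphere) auto
    moreover have "norm (x - z) \<le> norm (x - y) + norm (z - y)"
      using norm_triangle_ineq4[of "x - y" "z - y"] by simp
    ultimately show ?thesis
      using z \<open>norm (x - y) = 2\<close> by (elim joined_within_mono) simp
  qed
  then have "joined_within (sphere 0 1) x y (sqrt 2 * pi * norm (x - y))"
    by (rule joined_within_mono) (use sqrt2_pi_gt in \<open>intro mult_right_mono; simp\<close>)
  then show "intrinsic_dist (sphere 0 1) x y \<le> ennreal (sqrt 2 * pi * norm (x - y))"
    by (rule intrinsic_dist_le_if_joined_within)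
qed

end
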